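(* Let $d\ge 1$ be an integer. Then $\mathfrak{S}_{2d}\subsetneq\mathfrak{P}_{2d}$ if and only if $2d\ge 6$. (One always has $\mathfrak{S}_{2d}\subseteq\mathfrak{P}_{2d}$, so the statement says that $\mathfrak{S}_{2d}=\mathfrak{P}_{2d}$ for $2d\in\{2,4\}$ and that the inclusion is strict for all $2d\ge 6$.)
   Context: For $n,r\ge 1$ let $p_r^{(n)}=\frac{1}{n}(x_1^r+\dots+x_n^r)\in\mathbb{R}[x_1,\dots,x_n]$, and for a partition $\lambda=(\lambda_1,\dots,\lambda_k)$ let $p_\lambda^{(n)}=\prod_{i}p_{\lambda_i}^{(n)}$ (power means). Let $\pi(k)$ be the number of partitions of $k$; coordinates of $\mathbb{R}^{\pi(2d)}$ are indexed by the partitions $\lambda\vdash 2d$. A form is nonnegative if it takes nonnegative values on all of $\mathbb{R}^n$; it is a sum of squares if it is a finite sum of squares of real polynomials. $\mathfrak{S}_{2d}$ is the set of $c\in\mathbb{R}^{\pi(2d)}$ such that $\sum_{\lambda\vdash 2d}c_\lambda p_\lambda^{(n)}$ is a sum of squares for every $n\ge 2d$. $\mathfrak{P}_{2d}$ is the set of $c\in\mathbb{R}^{\pi(2d)}$ such that $\sum_{\lambda\vdash 2d}c_\lambda p_\lambda^{(n)}$ is nonnegative for every $n\ge 2d$. (It is known that these cones coincide with the closures of the unions over $n\ge 2d$ of the analogous cones defined for each $n$ with $p_\lambda^{(n)}$ replaced by the monomial mean $m_\lambda^{(n)}$, the arithmetic mean of all monomials obtained by permuting the variables in $x_1^{\lambda_1}\cdots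 x_k^{\lambda_k}$.) *)

theory Defs
  imports "HOL-Library.Poly_Mapping" "HOL-Library.Multiset" "HOL-Library.FuncSet" Complex_Main
begin

text \<open>
  The ring of real polynomials in the variables $x_0, x_1, x_2, \ldots$, as the monoid ring
  over the monoid of exponent vectors; the ring operations are those of \<open>Poly_Mapping\<close>.
\<close>
type_synonym rpoly = "(nat \<Rightarrow>\<^sub>0 nat) \<Rightarrow>\<^sub>0 real"

definition const_poly :: "real \<Rightarrow> rpoly" where
  "const_poly a = Poly_Mapping.single 0 a"

definition var_poly :: "nat \<Rightarrow> rpoly" where
  "var_poly i = Poly_Mapping.single (Poly_Mapping.single i 1) 1"

text \<open>The subring $\mathbb{R}[x_1, \ldots, x_n]$.\<close>
definition polys_in :: "nat \<Rightarrow> rpoly set" where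
  "polys_in n = {f. \<forall>m\<in>Poly_Mapping.keys f. Poly_Mapping.keys m \<subseteq> {1..n}}"

definition poly_eval :: "rpoly \<Rightarrow> (nat \<Rightarrow> real) \<Rightarrow> real" where
  "poly_eval f x =
    (\<Sum>m\<in>Poly_Mapping.keys f. Poly_Mapping.lookup f m *
      (\<Prod>i\<in>Poly_Mapping.keys m. x i ^ Poly_Mapping.lookup m i))"

text \<open>The points of $\mathbb{R}^n$ are the extensional functions on \<open>{1..n}\<close>.\<close>
definition nonneg_poly :: "nat \<Rightarrow> rpoly \<Rightarrow> bool" where
  "nonneg_poly n f \<longleftrightarrow> (\<forall>x \<in> {1..n} \<rightarrow>\<^sub>E (UNIV :: real set). poly_eval f x \<ge> 0)"

definition sum_of_squares :: "nat \<Rightarrow> rpoly \<Rightarrow> bool" where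
  "sum_of_squares n f \<longleftrightarrow> (\<exists>gs. set gs \<subseteq> polys_in n \<and> f = (\<Sum>g\<leftarrow>gs. g ^ 2))"

text \<open>Partitions of \<open>k\<close>, as multisets of positive parts.\<close>
definition number_partitions :: "nat \<Rightarrow> nat multiset set" where
  "number_partitions k = {l. 0 \<notin># l \<and> sum_mset l = k}"

definition power_mean :: "nat \<Rightarrow> nat \<Rightarrow> rpoly" where
  "power_mean n r = const_poly (1 / real n) * (\<Sum>i=1..n. var_poly i ^ r)"

definition power_mean_part :: "nat \<Rightarrow> nat multiset \<Rightarrow> rpoly" where
  "power_mean_part n l = (\<Prod>r\<in>#l. power_mean n r)"

definition mean_form :: "nat \<Rightarrow> nat \<Rightarrow> (nat multiset \<Rightarrow> real) \<Rightarrow> rpoly" where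
  "mean_form k n c = (\<Sum>l\<in>number_partitions k. const_poly (c l) * power_mean_part n l)"

text \<open>
  The cones $\mathfrak{S}_k$ and $\mathfrak{P}_k$; the space $\mathbb{R}^{\pi(k)}$ consists of
  the extensional functions on the set of partitions of \<open>k\<close>.
\<close>
definition sos_cone :: "nat \<Rightarrow> (nat multiset \<Rightarrow> real) set" where
  "sos_cone k = {c \<in> number_partitions k \<rightarrow>\<^sub>E UNIV. \<forall>n\<ge>k. sum_of_squares n (mean_form k n c)}"

definition nonneg_cone :: "nat \<Rightarrow> (nat multiset \<Rightarrow> real) set" where
  "nonneg_cone k = {c \<in> number_partitions k \<rightarrow>\<^sub>E UNIV. \<forall>n\<ge>k. nonneg_poly n (mean_form k n c)}"

text \<open>
  The set of partitions is finite, so the sum in \<open>mean_form\<close> is a genuine one.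
\<close>
lemma finite_number_partitions: "finite (number_partitions k)"
proof (rule finite_subset)
  show "number_partitions k \<subseteq> mset ` {xs. set xs \<subseteq> {..k} \<and> length xs \<le> k}"
  proof
    fix l assume l: "l \<in> number_partitions k"
    obtain xs where xs: "l = mset xs" by (metis ex_mset)
    have s: "sum_list xs = k" and z: "0 \<notin> set xs"
      using l by (auto simp: number_partitions_def xs sum_mset_sum_list)
    have "length xs \<le> sum_list xs" using z by (induction xs) auto
    moreover have "set xs \<subseteq> {..k}" using s member_le_sum_list by blast
    ultimately show "l \<in> mset ` {xs. set xs \<subseteq> {..k} \<and> length xs \<le> k}"
      using xs s by blast
  qed
  show "finite (mset ` {xs. set xs \<subseteq> {..k} \<and> length xs \<le> k})"
    by (intro finite_imageI finite_lists_length_le) simp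
qed

end

theory Submission
  imports Defs "HOL-Computational_Algebra.Polynomial" "HOL-Analysis.Convex"
begin

text \<open>
  A coefficient vector in the nonnegative cone gives a nonnegative value on the moments of every
  probability measure with finite support, because rational weights are dense. In degree 4, testing
  on measures with two atoms leaves a quadratic inequality in the variance which, once the means
  \<open>p\<^sub>3\<close> and \<open>p\<^sub>4\<close> have been absorbed by completing the square
  \<open>a E (y\<^sup>2 - v + l p\<^sub>1 y)\<^sup>2\<close> with \<open>y = x - p\<^sub>1\<close>, is itself a visible sum of squares.

  In degree \<open>2 d \<ge> 6\<close> take, with central moments \<open>m\<^sub>2, m\<^sub>4, m\<^sub>6\<close>, the form
  \<open>p\<^sub>1\<^bsup>2d-6\<^esup> (m\<^sub>6 - m\<^sub>2 m\<^sub>4 - 3 p\<^sub>1\<^sup>2 (m\<^sub>4 - m\<^sub>2\<^sup>2) + p\<^sub>1\<^sup>6)\<close>. It is nonnegative by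
  Cauchy-Schwarz (\<open>m\<^sub>4\<^sup>2 \<le> m\<^sub>2 m\<^sub>6\<close>) and the inequality of the means. On points built from four
  equal blocks of coordinates and with \<open>p\<^sub>1 = 1\<close> it becomes a Motzkin polynomial, which is no sum of
  squares: along two lines through \<open>(1, \<dots>, 1)\<close> it is constant, so that the summands have vanishing
  derivative in both directions, hence also in the direction of the sum; but on that line it is
  \<open>1 - 12 t\<^sup>4 + 16 t\<^sup>6\<close>, and \<open>t\<^sup>4\<close> would get a nonnegative coefficient.
\<close>

subsection \<open>Evaluation of polynomials and sums of squares\<close>

lemma poly_mapping_single_induct [case_names zero single add]:
  assumes "P 0" "\<And>m a. P (Poly_Mapping.single m a)" "\<And>f g. P f \<Longrightarrow> P g \<Longrightarrow> P (f + g)"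
  shows "P f"
proof (induction f rule: Poly_Mapping.update_induct)
  case const
  show ?case by (fact assms(1))
next
  case (update f a b)
  have "Poly_Mapping.update a b f = f + Poly_Mapping.single a b"
    using update.hyps
    by (intro poly_mapping_eqI) (auto simp: lookup_update lookup_add lookup_single when_def in_keys_iff)
  then show ?case using assms(2,3) update.IH by simp
qed

definition eval_monom :: "(nat \<Rightarrow>\<^sub>0 nat) \<Rightarrow> (nat \<Rightarrow> real) \<Rightarrow> real" where
  "eval_monom m x = (\<Prod>i\<in>Poly_Mapping.keys m. x i ^ Poly_Mapping.lookup m i)"

lemma eval_monom_superset:
  assumes "finite S" "Poly_Mapping.keys m \<subseteq> S"
  shows "eval_monom m x = (\<Prod>i\<in>S. x i ^ Poly_Mapping.lookup m i)"
  unfolding eval_monom_def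
  by (rule prod.mono_neutral_left) (use assms in \<open>auto simp: in_keys_iff\<close>)

lemma eval_monom_add: "eval_monom (m + m') x = eval_monom m x * eval_monom m' x"
proof -
  let ?S = "Poly_Mapping.keys m \<union> Poly_Mapping.keys m'"
  have "eval_monom (m + m') x = (\<Prod>i\<in>?S. x i ^ Poly_Mapping.lookup (m + m') i)"
    by (rule eval_monom_superset) (auto dest: subsetD[OF keys_add])
  also have "\<dots> = eval_monom m x * eval_monom m' x"
    by (simp add: eval_monom_superset[of ?S] lookup_add power_add prod.distrib)
  finally show ?thesis .
qed

lemma poly_eval_single: "poly_eval (Poly_Mapping.single m a) x = a * eval_monom m x"
  by (cases "a = 0") (simp_all add: poly_eval_def eval_monom_def)

lemma poly_eval_zero [simp]: "poly_eval 0 x = 0"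
  by (simp add: poly_eval_def)

lemma poly_eval_add [simp]: "poly_eval (f + g) x = poly_eval f x + poly_eval g x"
  unfolding poly_eval_def
  by (rule setsum_keys_plus_distrib) (simp_all add: algebra_simps)

lemma poly_eval_mult [simp]: "poly_eval (f * g) x = poly_eval f x * poly_eval g x"
proof (induction f rule: poly_mapping_single_induct)
  case (single m a)
  show ?case
    by (induction g rule: poly_mapping_single_induct)
      (simp_all add: mult_single poly_eval_single eval_monom_add distrib_left)
qed (simp_all add: distrib_right)

lemma poly_eval_const [simp]: "poly_eval (const_poly a) x = a"
  by (simp add: const_poly_def poly_eval_single eval_monom_def)

lemma poly_eval_var [simp]: "poly_eval (var_poly i) x = x i"
  by (simp add: var_poly_def poly_eval_single eval_monom_def)

lemma const_poly_zero [simp]: "const_poly 0 = 0"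
  by (simp add: const_poly_def)

lemma const_poly_one [simp]: "const_poly 1 = 1"
  by (simp add: const_poly_def)

lemma const_poly_add: "const_poly (a + b) = const_poly a + const_poly b"
  by (simp add: const_poly_def single_add)

lemma const_poly_diff: "const_poly (a - b) = const_poly a - const_poly b"
  by (simp add: const_poly_def single_diff)

lemma const_poly_uminus: "const_poly (- a) = - const_poly a"
  by (simp add: const_poly_def single_uminus)

lemma const_poly_mult: "const_poly (a * b) = const_poly a * const_poly b"
  by (simp add: const_poly_def mult_single)

lemma const_poly_numeral [simp]: "const_poly (numeral k) = numeral k"
  by (simp add: const_poly_def)

lemma const_poly_of_nat [simp]: "const_poly (of_nat k) = of_nat k"
  by (simp add: const_poly_def)

lemma poly_eval_one [simp]: "poly_eval 1 x = 1"
  by (metis poly_eval_const const_poly_one)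

lemma poly_eval_numeral [simp]: "poly_eval (numeral k) x = numeral k"
  by (metis poly_eval_const const_poly_numeral)

lemma poly_eval_uminus [simp]: "poly_eval (- f) x = - poly_eval f x"
  using poly_eval_add[of f "- f" x] by simp

lemma poly_eval_diff [simp]: "poly_eval (f - g) x = poly_eval f x - poly_eval g x"
  using poly_eval_add[of f "- g" x] by simp

lemma poly_eval_power [simp]: "poly_eval (f ^ k) x = poly_eval f x ^ k"
  by (induction k) simp_all

lemma poly_eval_sum [simp]: "poly_eval (sum f A) x = (\<Sum>i\<in>A. poly_eval (f i) x)"
  by (induction A rule: infinite_finite_induct) simp_all

lemma poly_eval_sum_list: "poly_eval (sum_list fs) x = (\<Sum>f\<leftarrow>fs. poly_eval f x)"
  by (induction fs) simp_all

lemma poly_eval_prod_mset: "poly_eval (\<Prod>r\<in>#l. f r) x = (\<Prod>r\<in>#l. poly_eval (f r) x)"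
  by (induction l) simp_all

lemma poly_eval_power_mean [simp]:
  "poly_eval (power_mean n r) x = (\<Sum>i=1..n. x i ^ r) / real n"
  by (simp add: power_mean_def)

lemma poly_eval_mean_form:
  "poly_eval (mean_form k n c) x =
    (\<Sum>l\<in>number_partitions k. c l * (\<Prod>r\<in>#l. (\<Sum>i=1..n. x i ^ r) / real n))"
  by (simp add: mean_form_def power_mean_part_def poly_eval_prod_mset)

lemma nonneg_poly_mean_form_iff:
  "nonneg_poly n (mean_form k n c) \<longleftrightarrow> (\<forall>x. poly_eval (mean_form k n c) x \<ge> 0)"
proof
  assume *: "nonneg_poly n (mean_form k n c)"
  show "\<forall>x. poly_eval (mean_form k n c) x \<ge> 0"
  proof
    fix x :: "nat \<Rightarrow> real"
    have "poly_eval (mean_form k n c) (restrict x {1..n}) \<ge> 0"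
      using * by (simp add: nonneg_poly_def)
    then show "poly_eval (mean_form k n c) x \<ge> 0"
      by (simp add: poly_eval_mean_form)
  qed
qed (simp add: nonneg_poly_def)

section \<open>Polynomials in n variables and operations on sums of squares\<close>

lemma polys_in_const [simp]: "const_poly a \<in> polys_in n"
  by (auto simp: polys_in_def const_poly_def)

lemma polys_in_var: "i \<in> {1..n} \<Longrightarrow> var_poly i \<in> polys_in n"
  by (auto simp: polys_in_def var_poly_def)

lemma polys_in_add [intro]: "f \<in> polys_in n \<Longrightarrow> g \<in> polys_in n \<Longrightarrow> f + g \<in> polys_in n"
  using keys_add[of f g] by (auto simp: polys_in_def)

lemma polys_in_mult [intro]:
  assumes "f \<in> polys_in n" "g \<in> polys_in n"
  shows "f * g \<in> polys_in n"
proof -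
  have "Poly_Mapping.keys m \<subseteq> {1..n}" if m: "m \<in> Poly_Mapping.keys (f * g)" for m
  proof -
    obtain a b where "m = a + b" "a \<in> Poly_Mapping.keys f" "b \<in> Poly_Mapping.keys g"
      using keys_mult[of f g] m by auto
    then show ?thesis using keys_add[of a b] assms unfolding polys_in_def by blast
  qed
  then show ?thesis by (simp add: polys_in_def)
qed

lemma polys_in_diff [intro]:
  assumes "f \<in> polys_in n" "g \<in> polys_in n"
  shows "f - g \<in> polys_in n"
proof -
  have "- g \<in> polys_in n"
    using polys_in_mult[OF polys_in_const[of "-1" n] assms(2)] by (simp add: const_poly_uminus)
  then show ?thesis using polys_in_add[OF assms(1), of "- g"] by simp
qed

lemma polys_in_power [intro]: "f \<in> polys_in n \<Longrightarrow> f ^ k \<in> polys_in n"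
  using polys_in_const[of 1 n] by (induction k) auto

lemma polys_in_sum [intro]: "(\<And>i. i \<in> A \<Longrightarrow> f i \<in> polys_in n) \<Longrightarrow> sum f A \<in> polys_in n"
  using polys_in_const[of 0 n] by (induction A rule: infinite_finite_induct) auto

lemma polys_in_power_mean [simp]: "power_mean n r \<in> polys_in n"
  unfolding power_mean_def by (intro polys_in_mult polys_in_const polys_in_sum polys_in_power polys_in_var)

lemma sos_square: "g \<in> polys_in n \<Longrightarrow> sum_of_squares n (g ^ 2)"
  unfolding sum_of_squares_def by (intro exI[of _ "[g]"]) simp

lemma sos_add:
  assumes "sum_of_squares n f" "sum_of_squares n g"
  shows "sum_of_squares n (f + g)"
proof -
  from assms obtain fs gs where "set fs \<subseteq> polys_in n" "f = (\<Sum>h\<leftarrow>fs. h ^ 2)"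
    "set gs \<subseteq> polys_in n" "g = (\<Sum>h\<leftarrow>gs. h ^ 2)"
    unfolding sum_of_squares_def by blast
  then show ?thesis unfolding sum_of_squares_def by (intro exI[of _ "fs @ gs"]) simp
qed

lemma sos_square_mult:
  assumes "h \<in> polys_in n" "sum_of_squares n f"
  shows "sum_of_squares n (h ^ 2 * f)"
proof -
  from assms(2) obtain fs where fs: "set fs \<subseteq> polys_in n" "f = (\<Sum>g\<leftarrow>fs. g ^ 2)"
    unfolding sum_of_squares_def by blast
  have "h ^ 2 * f = (\<Sum>g\<leftarrow>map ((*) h) fs. g ^ 2)"
    unfolding fs(2) by (induction fs) (simp_all add: distrib_left power_mult_distrib)
  moreover have "set (map ((*) h) fs) \<subseteq> polys_in n" using fs(1) assms(1) by auto
  ultimately show ?thesis unfolding sum_of_squares_def by blast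
qed

lemma sos_scale:
  assumes "a \<ge> 0" "sum_of_squares n f"
  shows "sum_of_squares n (const_poly a * f)"
  using sos_square_mult[OF polys_in_const[of "sqrt a" n] assms(2)] assms(1)
  by (simp add: power2_eq_square flip: const_poly_mult)

lemma sos_sum:
  "(\<And>i. i \<in> A \<Longrightarrow> sum_of_squares n (f i)) \<Longrightarrow> sum_of_squares n (sum f A)"
proof (induction A rule: infinite_finite_induct)
  case empty
  show ?case unfolding sum_of_squares_def by (intro exI[of _ "[]"]) simp
next
  case (infinite A)
  then show ?case unfolding sum_of_squares_def by (intro exI[of _ "[]"]) simp
qed (simp add: sos_add)

lemma sos_imp_poly_eval_nonneg:
  assumes "sum_of_squares n f"
  shows "poly_eval f x \<ge> 0"
proof -
  obtain gs where "f = (\<Sum>g\<leftarrow>gs. g ^ 2)" using assms unfolding sum_of_squares_def by blast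
  then show ?thesis by (auto simp: poly_eval_sum_list intro!: sum_list_nonneg)
qed

lemma sos_cone_subset_nonneg_cone: "sos_cone k \<subseteq> nonneg_cone k"
  by (auto simp: sos_cone_def nonneg_cone_def nonneg_poly_def sos_imp_poly_eval_nonneg)

subsection \<open>Partitions of two and of four\<close>

lemma number_partitions_0: "number_partitions 0 = {{#}}"
proof -
  have "l = {#}" if "0 \<notin># l" "sum_mset l = 0" for l :: "nat multiset"
    using that by (cases l) auto
  then show ?thesis by (auto simp: number_partitions_def)
qed

lemma number_partitions_rec:
  assumes "k > 0"
  shows "number_partitions k = (\<Union>a\<in>{1..k}. add_mset a ` number_partitions (k - a))"
proof (intro equalityI subsetI)
  fix l assume l: "l \<in> number_partitions k"
  then obtain a l' where "l = add_mset a l'" using assms by (cases l) (auto simp: number_partitions_def)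
  then show "l \<in> (\<Union>a\<in>{1..k}. add_mset a ` number_partitions (k - a))"
    using l by (auto simp: number_partitions_def intro!: bexI[of _ a])
qed (auto simp: number_partitions_def)

lemma number_partitions_1: "number_partitions (Suc 0) = {{#1#}}"
  by (simp add: number_partitions_rec number_partitions_0)

lemma number_partitions_2: "number_partitions 2 = {{#2#}, {#1, 1#}}"
proof -
  have "{1..2::nat} = {1, 2}" by auto
  then show ?thesis
    by (simp add: number_partitions_rec[of 2] number_partitions_0 number_partitions_1 insert_commute)
qed

lemma number_partitions_3: "number_partitions 3 = {{#3#}, {#2, 1#}, {#1, 1, 1#}}"
proof -
  have "{1..3::nat} = {1, 2, 3}" by auto
  then show ?thesis
    by (auto simp: number_partitions_rec[of 3] number_partitions_0 number_partitions_1
        number_partitions_2 add_mset_commute)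
qed

lemma number_partitions_4:
  "number_partitions 4 = {{#4#}, {#3, 1#}, {#2, 2#}, {#2, 1, 1#}, {#1, 1, 1, 1#}}"
proof -
  have "{1..4::nat} = {1, 2, 3, 4}" by auto
  then show ?thesis
    by (auto simp: number_partitions_rec[of 4] number_partitions_0 number_partitions_1
        number_partitions_2 number_partitions_3 add_mset_commute)
qed

lemma sum_number_partitions_2:
  "(\<Sum>l\<in>number_partitions 2. f l) = f {#2#} + f {#1, 1#}"
  by (simp add: number_partitions_2)

lemma sum_number_partitions_4:
  "(\<Sum>l\<in>number_partitions 4. f l) =
    f {#4#} + f {#3, 1#} + f {#2, 2#} + f {#2, 1, 1#} + f {#1, 1, 1, 1#}"
  by (simp add: number_partitions_4 add_eq_conv_ex add.assoc)

subsection \<open>Two-atom measures as limits of power means\<close>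

lemma tendsto_prod_mset:
  fixes f :: "'a \<Rightarrow> 'b \<Rightarrow> real"
  assumes "\<And>r. ((\<lambda>n. f n r) \<longlongrightarrow> g r) F"
  shows "((\<lambda>n. \<Prod>r\<in>#l. f n r) \<longlongrightarrow> (\<Prod>r\<in>#l. g r)) F"
  by (induction l) (auto intro!: tendsto_mult assms)

lemma floor_mult_div_tendsto:
  fixes w :: real
  assumes "w \<ge> 0"
  shows "(\<lambda>n. real (nat \<lfloor>w * real n\<rfloor>) / real n) \<longlonglongrightarrow> w"
proof (rule tendsto_sandwich)
  show "(\<lambda>n. w - 1 / real n) \<longlonglongrightarrow> w"
    using tendsto_diff[OF tendsto_const lim_1_over_n, of w] by simp
  show "\<forall>\<^sub>F n in sequentially. w - 1 / real n \<le> real (nat \<lfloor>w * real n\<rfloor>) / real n"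
    using eventually_gt_at_top[of "0 :: nat"]
  proof eventually_elim
    case (elim n)
    have "w * real n - 1 \<le> real (nat \<lfloor>w * real n\<rfloor>)" using assms by linarith
    then have "(w * real n - 1) / real n \<le> real (nat \<lfloor>w * real n\<rfloor>) / real n"
      by (rule divide_right_mono) simp
    then show ?case using elim by (simp add: diff_divide_distrib)
  qed
  show "\<forall>\<^sub>F n in sequentially. real (nat \<lfloor>w * real n\<rfloor>) / real n \<le> w"
    using eventually_gt_at_top[of "0 :: nat"]
  proof eventually_elim
    case (elim n)
    have "real (nat \<lfloor>w * real n\<rfloor>) \<le> w * real n" using assms by simp
    then show ?case using elim by (simp add: divide_le_eq)
  qed
qed simp

text \<open>If the first floor(w n) of n coordinates are \<alpha> and the others \<beta>, the power
  means are the moments of a two-atom measure whose weight tends to w. The expression is continuous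
  in the weight.\<close>

lemma nonneg_cone_two_atoms:
  fixes w :: real
  assumes c: "c \<in> nonneg_cone k" and w: "0 \<le> w" "w \<le> 1"
  shows "0 \<le> (\<Sum>l\<in>number_partitions k. c l * (\<Prod>r\<in>#l. w * \<alpha> ^ r + (1 - w) * \<beta> ^ r))"
proof -
  define t where "t n = real (nat \<lfloor>w * real n\<rfloor>) / real n" for n
  define G where "G u = (\<Sum>l\<in>number_partitions k. c l * (\<Prod>r\<in>#l. u * \<alpha> ^ r + (1 - u) * \<beta> ^ r))" for u
  have "t \<longlonglongrightarrow> w" unfolding t_def by (rule floor_mult_div_tendsto) (fact w)
  then have lim: "(\<lambda>n. G (t n)) \<longlonglongrightarrow> G w"
    unfolding G_def by (intro tendsto_sum tendsto_mult tendsto_prod_mset tendsto_intros)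
  \<comment> \<open>The bound 1 avoids division by zero; the bound \<open>k\<close> is the range of
    n in \<open>nonneg_cone\<close>.\<close>
  have "G (t n) \<ge> 0" if n: "n \<ge> max 1 k" for n
  proof -
    define j where "j = nat \<lfloor>w * real n\<rfloor>"
    define x where "x i = (if i \<le> j then \<alpha> else \<beta>)" for i :: nat
    have "w * real n \<le> real n" using w by (simp add: mult_left_le_one_le)
    then have j: "j \<le> n" unfolding j_def using w by (simp add: nat_le_iff floor_le_iff)
    have "(\<Sum>i=1..n. x i ^ r) / real n = t n * \<alpha> ^ r + (1 - t n) * \<beta> ^ r" for r
    proof -
      have "(\<Sum>i=1..n. x i ^ r) = (\<Sum>i=1..j. x i ^ r) + (\<Sum>i=Suc j..n. x i ^ r)"
        using sum.ub_add_nat[of 1 j "\<lambda>i. x i ^ r" "n - j"] j by simp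
      also have "\<dots> = real j * \<alpha> ^ r + (real n - real j) * \<beta> ^ r"
        using j by (simp add: x_def of_nat_diff)
      also have "\<dots> / real n = t n * \<alpha> ^ r + (1 - t n) * \<beta> ^ r"
        using n by (simp add: t_def j_def field_simps)
      finally show ?thesis .
    qed
    then have "G (t n) = poly_eval (mean_form k n c) x"
      by (simp add: G_def poly_eval_mean_form)
    then show ?thesis
      using c n by (simp add: nonneg_cone_def nonneg_poly_mean_form_iff)
  qed
  then have "G w \<ge> 0" by (intro LIMSEQ_le_const[OF lim]) blast
  then show ?thesis by (simp add: G_def)
qed

text \<open>The third bound yields a certificate: the quadratic is (sqrt A v - sqrt C)^2 + (B + 2
  sqrt A sqrt C) v. For A, C > 0 it comes from v = sqrt C / sqrt A, where the square
  vanishes.\<close>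

lemma quadratic_nonneg_on_halfline:
  fixes A B C :: real
  assumes nn: "\<And>v. v \<ge> 0 \<Longrightarrow> A * v ^ 2 + B * v + C \<ge> 0"
  shows "A \<ge> 0" "C \<ge> 0" "B + 2 * sqrt A * sqrt C \<ge> 0"
proof -
  show C: "C \<ge> 0" using nn[of 0] by simp
  show A: "A \<ge> 0"
  proof (rule ccontr)
    assume A: "\<not> A \<ge> 0"
    \<comment> \<open>Here A v = A - |B| - |C|, so that A v^2 outweighs the other two terms because
      v \<ge> 1.\<close>
    define v where "v = 1 + (\<bar>B\<bar> + \<bar>C\<bar>) / (- A)"
    have v: "v \<ge> 1" unfolding v_def using A by (simp add: divide_nonneg_neg)
    have "A * v = A - \<bar>B\<bar> - \<bar>C\<bar>" unfolding v_def using A by (simp add: field_simps)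
    then have "A * v ^ 2 = (A - \<bar>B\<bar> - \<bar>C\<bar>) * v" by (simp add: power2_eq_square)
    moreover have "B * v \<le> \<bar>B\<bar> * v" using v by (intro mult_right_mono) auto
    moreover have "C \<le> \<bar>C\<bar> * v" using v mult_left_mono[of 1 v "\<bar>C\<bar>"] by simp
    ultimately have "A * v ^ 2 + B * v + C \<le> A * v" by (simp add: algebra_simps)
    also have "\<dots> < 0" using A v by (simp add: mult_neg_pos)
    finally show False using nn[of v] v by simp
  qed
  show "B + 2 * sqrt A * sqrt C \<ge> 0"
  proof (cases "A = 0")
    case True
    have "B \<ge> 0"
    proof (rule ccontr)
      assume "\<not> B \<ge> 0"
      then show False using nn[of "(C + 1) / (- B)"] C True by (simp add: field_simps)
    qed
    then show ?thesis using True by simp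
  next
    case False
    then have A: "A > 0" using A by simp
    have "B \<ge> 0" if "C = 0"
    proof (rule ccontr)
      assume B: "\<not> B \<ge> 0"
      have "A * (- B / (2 * A)) ^ 2 + B * (- B / (2 * A)) + C = - (B ^ 2 / (4 * A))"
        using A that by (simp add: field_simps power2_eq_square)
      also have "\<dots> < 0" using A B by simp
      finally show False using nn[of "- B / (2 * A)"] A B by (simp add: divide_nonpos_pos)
    qed
    moreover have ?thesis if "C > 0"
    proof -
      define q where "q = sqrt C / sqrt A"
      have q: "q > 0" using A that by (simp add: q_def)
      have "A * q ^ 2 + B * q + C = (B + 2 * sqrt A * sqrt C) * q"
        using A that by (simp add: q_def field_simps power_divide)
      then have "(B + 2 * sqrt A * sqrt C) * q \<ge> 0" using nn[of q] q by simp
      then show ?thesis using q by (simp add: zero_le_mult_iff)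
    qed
    ultimately show ?thesis using C by fastforce
  qed
qed

section \<open>Averages of squares as polynomial identities in the power means\<close>

lemma mean_const_poly: "n > 0 \<Longrightarrow> const_poly (1 / real n) * of_nat n = 1"
  by (simp flip: const_poly_of_nat const_poly_mult)

lemma mean_deviation_square:
  assumes "n > 0"
  shows "const_poly (1 / real n) * (\<Sum>i=1..n. (var_poly i - power_mean n 1) ^ 2) =
    power_mean n 2 - power_mean n 1 ^ 2"
proof -
  let ?k = "const_poly (1 / real n)" and ?p = "power_mean n"
  have "?k * (\<Sum>i=1..n. (var_poly i - ?p 1) ^ 2) =
    ?k * (\<Sum>i=1..n. var_poly i ^ 2 + (- 2 * ?p 1) * var_poly i ^ 1 + ?p 1 ^ 2)"
    by (simp add: power2_eq_square algebra_simps)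
  also have "\<dots> = ?p 2 - 2 * ?p 1 * ?p 1 + (?k * of_nat n) * ?p 1 ^ 2"
    unfolding sum.distrib power_mean_def[of n 2] sum_distrib_left[symmetric] distrib_left
    by (simp add: power_mean_def[of n "Suc 0"] ac_simps)
  also have "\<dots> = ?p 2 - ?p 1 ^ 2"
    unfolding mean_const_poly[OF assms] by (simp add: power2_eq_square)
  finally show ?thesis .
qed

text \<open>The coefficients \<open>b\<close> and \<open>c\<close> are arbitrary polynomials that do
  not depend on the index i, so they may contain power means, as completing the square in degree 4
  requires.\<close>

lemma mean_quadratic_square:
  assumes "n > 0"
  shows "const_poly (1 / real n) * (\<Sum>i=1..n. (var_poly i ^ 2 + b * var_poly i + c) ^ 2) =
    power_mean n 4 + 2 * b * power_mean n 3 + (b ^ 2 + 2 * c) * power_mean n 2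
      + 2 * b * c * power_mean n 1 + c ^ 2"
proof -
  let ?k = "const_poly (1 / real n)" and ?p = "power_mean n"
  have "(v ^ 2 + b * v + c) ^ 2 =
      v ^ 4 + 2 * b * v ^ 3 + (b ^ 2 + 2 * c) * v ^ 2 + 2 * b * c * v ^ 1 + c ^ 2" for v :: rpoly
    by (simp add: power2_eq_square power3_eq_cube power4_eq_xxxx algebra_simps)
  then have "?k * (\<Sum>i=1..n. (var_poly i ^ 2 + b * var_poly i + c) ^ 2) =
    ?k * (\<Sum>i=1..n. var_poly i ^ 4 + 2 * b * var_poly i ^ 3 + (b ^ 2 + 2 * c) * var_poly i ^ 2
      + 2 * b * c * var_poly i ^ 1 + c ^ 2)"
    by simp
  also have "\<dots> = ?p 4 + 2 * b * ?p 3 + (b ^ 2 + 2 * c) * ?p 2 + 2 * b * c * ?p 1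
      + (?k * of_nat n) * c ^ 2"
    unfolding sum.distrib power_mean_def sum_distrib_left[symmetric] distrib_left
    by (simp add: ac_simps)
  finally show ?thesis using assms by (simp add: mean_const_poly)
qed

subsection \<open>Degrees two and four\<close>

text \<open>The form is a (p2 - p1^2) + (a + b) p1^2. The uniform measure on 1 and -1 tests a, the
  point mass at 1 tests a + b.\<close>

lemma nonneg_cone_2_subset_sos_cone: "nonneg_cone 2 \<subseteq> sos_cone 2"
proof
  fix c assume c: "c \<in> nonneg_cone 2"
  define a b where "a = c {#2#}" and "b = c {#1, 1#}"
  have a: "a \<ge> 0"
    using nonneg_cone_two_atoms[OF c, of "1 / 2" 1 "-1"]
    by (simp add: sum_number_partitions_2 a_def)
  have ab: "a + b \<ge> 0"
    using nonneg_cone_two_atoms[OF c, of 1 1 1]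
    by (simp add: sum_number_partitions_2 a_def b_def)
  have "sum_of_squares n (mean_form 2 n c)" if n: "n \<ge> 2" for n
  proof -
    have "mean_form 2 n c = const_poly a * power_mean n 2 + const_poly b * power_mean n 1 ^ 2"
      by (simp add: mean_form_def sum_number_partitions_2 power_mean_part_def a_def b_def
          power2_eq_square)
    also have "\<dots> = const_poly a * (power_mean n 2 - power_mean n 1 ^ 2)
        + const_poly (a + b) * power_mean n 1 ^ 2"
      by (simp add: const_poly_add algebra_simps)
    also have "\<dots> = const_poly a *
        (const_poly (1 / real n) * (\<Sum>i=1..n. (var_poly i - power_mean n 1) ^ 2))
        + const_poly (a + b) * power_mean n 1 ^ 2"
      using n by (subst mean_deviation_square) simp_all
    finally show ?thesis
      using a ab
      by (auto intro!: sos_add sos_scale sos_sum sos_square polys_in_diff polys_in_var)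
  qed
  then show "c \<in> sos_cone 2" using c by (simp add: sos_cone_def nonneg_cone_def)
qed

text \<open>
  The atoms \<open>1 + y\<close> with \<open>y\<close> running through the two roots of \<open>y\<^sup>2 + l y - v\<close> carry a measure of
  mean 1 and variance \<open>v\<close> whose third and fourth central moments are \<open>- l v\<close> and
  \<open>v\<^sup>2 + l\<^sup>2 v\<close>.
\<close>
lemma nonneg_cone_4_inequality:
  fixes l v :: real
  assumes c: "c \<in> nonneg_cone 4" and v: "v \<ge> 0"
  defines "a \<equiv> c {#4#}" and "b \<equiv> c {#3, 1#}" and "s \<equiv> c {#2, 2#}"
    and "d \<equiv> c {#2, 1, 1#}" and "e \<equiv> c {#1, 1, 1, 1#}"
  shows "(a + s) * v ^ 2 + (a * l ^ 2 - (4 * a + b) * l + (6 * a + 3 * b + 2 * s + d)) * v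
    + (a + b + s + d + e) \<ge> 0"
proof -
  obtain w y z :: real where w: "0 \<le> w" "w \<le> 1" "w * y + (1 - w) * z = 0"
    and y: "y ^ 2 = v - l * y" and z: "z ^ 2 = v - l * z"
  proof (cases "v = 0")
    \<comment> \<open>A point mass serves here; the weight below divides by \<open>D\<close>, which
      is 0 for v = l = 0.\<close>
    case True
    then show ?thesis using that[of 1 0 0] by simp
  next
    case False
    then have v: "v > 0" using v by simp
    define D where "D = sqrt (l ^ 2 + 4 * v)"
    have D2: "D ^ 2 = l ^ 2 + 4 * v" using v by (simp add: D_def)
    have "sqrt (l ^ 2) < D" unfolding D_def using v by (intro real_sqrt_less_mono) simp
    then have D: "\<bar>l\<bar> < D" by simp
    show ?thesis
    \<comment> \<open>The two roots, with the weight that makes their mean zero.\<close>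
    proof (rule that[of "(D + l) / (2 * D)" "(D - l) / 2" "- (D + l) / 2"])
      show "((D - l) / 2) ^ 2 = v - l * ((D - l) / 2)" "(- (D + l) / 2) ^ 2 = v - l * (- (D + l) / 2)"
        using D2 by (simp_all add: power2_eq_square field_simps)
    qed (use D in \<open>auto simp: field_simps\<close>)
  qed
  define M where "M r = w * (1 + y) ^ r + (1 - w) * (1 + z) ^ r" for r
  have y3: "y ^ 3 = v * y - l * y ^ 2" and z3: "z ^ 3 = v * z - l * z ^ 2"
    using arg_cong[OF y, of "\<lambda>x. y * x"] arg_cong[OF z, of "\<lambda>x. z * x"]
    by (simp_all add: power2_eq_square power3_eq_cube algebra_simps)
  have y4: "y ^ 4 = (v - l * y) ^ 2" and z4: "z ^ 4 = (v - l * z) ^ 2"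
    unfolding y[symmetric] z[symmetric] by simp_all
  have m2: "w * y ^ 2 + (1 - w) * z ^ 2 = v"
  proof -
    have "w * y ^ 2 + (1 - w) * z ^ 2 = v - l * (w * y + (1 - w) * z)"
      unfolding y z by (simp add: algebra_simps)
    then show ?thesis using w by simp
  qed
  have m3: "w * y ^ 3 + (1 - w) * z ^ 3 = - l * v"
  proof -
    have "w * y ^ 3 + (1 - w) * z ^ 3
      = v * (w * y + (1 - w) * z) - l * (w * y ^ 2 + (1 - w) * z ^ 2)"
      unfolding y3 z3 by (simp add: algebra_simps)
    then show ?thesis using w m2 by simp
  qed
  have m4: "w * y ^ 4 + (1 - w) * z ^ 4 = v ^ 2 + l ^ 2 * v"
  proof -
    have "w * y ^ 4 + (1 - w) * z ^ 4 = v ^ 2 - 2 * l * v * (w * y + (1 - w) * z)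
      + l ^ 2 * (w * y ^ 2 + (1 - w) * z ^ 2)"
      unfolding y4 z4 by (simp add: algebra_simps power2_eq_square)
    then show ?thesis using w m2 by simp
  qed
  have M1: "M 1 = 1"
    using w by (simp add: M_def algebra_simps)
  have "M 2 = 1 + 2 * (w * y + (1 - w) * z) + (w * y ^ 2 + (1 - w) * z ^ 2)"
    by (simp add: M_def power2_eq_square algebra_simps)
  then have M2: "M 2 = 1 + v" using w m2 by simp
  have "M 3 = 1 + 3 * (w * y + (1 - w) * z) + 3 * (w * y ^ 2 + (1 - w) * z ^ 2)
      + (w * y ^ 3 + (1 - w) * z ^ 3)"
    by (simp add: M_def power2_eq_square power3_eq_cube algebra_simps)
  then have M3: "M 3 = 1 + 3 * v - l * v" using w m2 m3 by simp
  have "M 4 = 1 + 4 * (w * y + (1 - w) * z) + 6 * (w * y ^ 2 + (1 - w) * z ^ 2)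
      + 4 * (w * y ^ 3 + (1 - w) * z ^ 3) + (w * y ^ 4 + (1 - w) * z ^ 4)"
    by (simp add: M_def power2_eq_square power3_eq_cube power4_eq_xxxx algebra_simps)
  then have M4: "M 4 = 1 + 6 * v - 4 * l * v + v ^ 2 + l ^ 2 * v" using w m2 m3 m4 by simp
  have "0 \<le> (\<Sum>l\<in>number_partitions 4. c l * (\<Prod>r\<in>#l. M r))"
    using nonneg_cone_two_atoms[OF c w(1,2), of "1 + y" "1 + z"] by (simp add: M_def)
  also have "\<dots> = a * M 4 + b * (M 3 * M 1) + s * (M 2 * M 2) + d * (M 2 * (M 1 * M 1))
      + e * (M 1 * (M 1 * (M 1 * M 1)))"
    by (simp add: sum_number_partitions_4 a_def b_def s_def d_def e_def)
  also have "\<dots> = (a + s) * v ^ 2 + (a * l ^ 2 - (4 * a + b) * l + (6 * a + 3 * b + 2 * s + d)) * v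
    + (a + b + s + d + e)"
    unfolding M1 M2 M3 M4 by (simp add: algebra_simps power2_eq_square)
  finally show ?thesis .
qed

text \<open>Put y = x - p1 and V = p2 - p1^2. Since x^2 + g x + h = y^2 + l p1 y - V, the bracket
  after \<open>a\<close> stands for the mean of the square of this; it absorbs p3 and p4 and leaves
  a quadratic form in V and p1^2. With b, s, d, e expressed by a, l, u, t, r this is a plain ring
  identity, usable for constant polynomials.\<close>

lemma quartic_mean_identity:
  fixes a l u t r p1 p2 p3 p4 :: "'a :: comm_ring_1"
  defines "b \<equiv> 2 * a * l - 4 * a" and "s \<equiv> u ^ 2 - a"
  defines "d \<equiv> r - 2 * u * t + a * l ^ 2 - 6 * a - 3 * b - 2 * s"
  defines "e \<equiv> t ^ 2 - a - b - s - d"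
  defines "g \<equiv> (l - 2) * p1" and "h \<equiv> (2 - l) * p1 ^ 2 - p2"
  shows "a * p4 + b * (p3 * p1) + s * (p2 * p2) + d * (p2 * (p1 * p1)) + e * (p1 * (p1 * (p1 * p1)))
    = a * (p4 + 2 * g * p3 + (g ^ 2 + 2 * h) * p2 + 2 * g * h * p1 + h ^ 2)
      + (u * (p2 - p1 ^ 2) - t * p1 ^ 2) ^ 2 + r * (p1 ^ 2 * (p2 - p1 ^ 2))"
  unfolding e_def d_def s_def b_def g_def h_def
  by (simp add: power2_eq_square algebra_simps)

text \<open>The inequality in \<open>v\<close> is used at the \<open>l\<close> that minimises its
  left side. Its coefficients A, B, C then supply the roots u, t and the remainder r \<ge> 0 for
  \<open>quartic_mean_identity\<close>.\<close>

lemma nonneg_cone_4_subset_sos_cone: "nonneg_cone 4 \<subseteq> sos_cone 4"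
proof
  fix c assume c: "c \<in> nonneg_cone 4"
  define a b s d e where "a = c {#4#}" and "b = c {#3, 1#}" and "s = c {#2, 2#}"
    and "d = c {#2, 1, 1#}" and "e = c {#1, 1, 1, 1#}"
  note defs = a_def b_def s_def d_def e_def
  define K where "K = a + s + (6 * a + 3 * b + 2 * s + d) + (a + b + s + d + e)"
  have K: "a * l ^ 2 - (4 * a + b) * l + K \<ge> 0" for l
    using nonneg_cone_4_inequality[OF c, of 1 l] by (simp add: defs K_def algebra_simps)
  have a: "a \<ge> 0"
    by (rule quadratic_nonneg_on_halfline(1)[of a "- (4 * a + b)" K]) (use K in \<open>simp add: algebra_simps\<close>)
  \<comment> \<open>The vertex of the quadratic in \<open>l\<close>. If a = 0, division yields l =
    0, and 2 a l = 4 a + b still holds because then b = 0.\<close>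
  define l where "l = (4 * a + b) / (2 * a)"
  have al: "2 * a * l = 4 * a + b"
  proof (cases "a = 0")
    case True
    have "b = 0"
    proof (rule ccontr)
      assume "b \<noteq> 0"
      then show False using K[of "(K + 1) / b"] True by simp
    qed
    then show ?thesis using True by simp
  qed (simp add: l_def)
  define A B C where "A = a + s" and "B = 6 * a + 3 * b + 2 * s + d - a * l ^ 2"
    and "C = a + b + s + d + e"
  have ABC: "A * v ^ 2 + B * v + C \<ge> 0" if "v \<ge> 0" for v
  proof -
    have eq: "a * l ^ 2 - (4 * a + b) * l + x = x - a * l ^ 2" for x
      unfolding al[symmetric] by (simp add: power2_eq_square)
    show ?thesis
      using nonneg_cone_4_inequality[OF c that, of l, folded defs]
      unfolding eq A_def B_def C_def .
  qed
  note * = quadratic_nonneg_on_halfline[OF ABC]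
  define u t r where "u = sqrt A" and "t = sqrt C" and "r = B + 2 * sqrt A * sqrt C"
  have u2: "u ^ 2 = A" and t2: "t ^ 2 = C" using * by (simp_all add: u_def t_def)
  have beq: "b = 2 * a * l - 4 * a" using al by simp
  have seq: "s = u ^ 2 - a" using u2 by (simp add: A_def)
  have deq: "d = r - 2 * u * t + a * l ^ 2 - 6 * a - 3 * b - 2 * s"
    by (simp add: r_def u_def t_def B_def)
  have eeq: "e = t ^ 2 - a - b - s - d" using t2 by (simp add: C_def)
  have "sum_of_squares n (mean_form 4 n c)" if n: "n \<ge> 4" for n
  proof -
    let ?p = "power_mean n" and ?k = "const_poly (1 / real n)" and ?c = const_poly
    let ?g = "(?c l - 2) * ?p 1" and ?h = "(2 - ?c l) * ?p 1 ^ 2 - ?p 2"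
    note hom = const_poly_diff const_poly_add const_poly_mult const_poly_numeral power2_eq_square
    \<comment> \<open>The relations are carried over to constant polynomials and written out in a,
      l, u, t, r, the form in which \<open>quartic_mean_identity\<close> matches.\<close>
    have b': "?c b = 2 * ?c a * ?c l - 4 * ?c a" unfolding beq by (simp add: hom)
    have s': "?c s = ?c u ^ 2 - ?c a" unfolding seq by (simp add: hom)
    have d': "?c d = ?c r - 2 * ?c u * ?c t + ?c a * ?c l ^ 2 - 6 * ?c a
        - 3 * (2 * ?c a * ?c l - 4 * ?c a) - 2 * (?c u ^ 2 - ?c a)"
      unfolding b'[symmetric] s'[symmetric] by (subst deq) (simp add: hom)
    have e': "?c e = ?c t ^ 2 - ?c a - (2 * ?c a * ?c l - 4 * ?c a) - (?c u ^ 2 - ?c a)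
        - (?c r - 2 * ?c u * ?c t + ?c a * ?c l ^ 2 - 6 * ?c a
        - 3 * (2 * ?c a * ?c l - 4 * ?c a) - 2 * (?c u ^ 2 - ?c a))"
      unfolding d'[symmetric] unfolding b'[symmetric] s'[symmetric] by (subst eeq) (simp add: hom)
    have "mean_form 4 n c = ?c a * ?p 4 + ?c b * (?p 3 * ?p 1) + ?c s * (?p 2 * ?p 2)
        + ?c d * (?p 2 * (?p 1 * ?p 1)) + ?c e * (?p 1 * (?p 1 * (?p 1 * ?p 1)))"
      by (simp add: mean_form_def sum_number_partitions_4 power_mean_part_def defs)
    also have "\<dots> = ?c a * (?p 4 + 2 * ?g * ?p 3 + (?g ^ 2 + 2 * ?h) * ?p 2 + 2 * ?g * ?h * ?p 1 + ?h ^ 2)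
      + (?c u * (?p 2 - ?p 1 ^ 2) - ?c t * ?p 1 ^ 2) ^ 2 + ?c r * (?p 1 ^ 2 * (?p 2 - ?p 1 ^ 2))"
      unfolding e' d' b' s' by (rule quartic_mean_identity)
    also have "\<dots> = ?c a * (?k * (\<Sum>i=1..n. (var_poly i ^ 2 + ?g * var_poly i + ?h) ^ 2))
      + (?c u * (?p 2 - ?p 1 ^ 2) - ?c t * ?p 1 ^ 2) ^ 2
      + ?c r * (?p 1 ^ 2 * (?k * (\<Sum>i=1..n. (var_poly i - ?p 1) ^ 2)))"
      using n by (subst mean_quadratic_square, simp, subst mean_deviation_square) simp_all
    finally have eq: "mean_form 4 n c = \<dots>" .
    have [simp]: "2 \<in> polys_in n" using polys_in_const[of 2 n] by simp
    show ?thesis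
      unfolding eq using a *(3)
      by (intro sos_add sos_scale sos_sum sos_square_mult sos_square)
        (auto simp: r_def intro!: polys_in_diff polys_in_add polys_in_mult polys_in_power polys_in_var)
  qed
  then show "c \<in> sos_cone 4" using c by (simp add: sos_cone_def nonneg_cone_def)
qed

subsection \<open>A Motzkin form in central moments\<close>

text \<open>One \<open>c\<close> has to serve all n at once. Closure under ring operations replaces
  computing the coefficients of the Motzkin form. The mean of zeroth powers is 1 only for n > 0,
  whence the restriction.\<close>

definition mean_representable :: "nat \<Rightarrow> (nat \<Rightarrow> rpoly) \<Rightarrow> bool" where
  "mean_representable k F \<longleftrightarrow> (\<exists>c. \<forall>n>0. F n = mean_form k n c)"

lemma mean_form_restrict: "mean_form k n (restrict c (number_partitions k)) = mean_form k n c"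
  by (simp add: mean_form_def)

lemma mean_representable_cong:
  "mean_representable k F \<Longrightarrow> (\<And>n. n > 0 \<Longrightarrow> F n = G n) \<Longrightarrow> mean_representable k G"
  by (auto simp: mean_representable_def)

lemma mean_representable_add:
  assumes "mean_representable k F" "mean_representable k G"
  shows "mean_representable k (\<lambda>n. F n + G n)"
proof -
  from assms obtain c c' where "\<forall>n>0. F n = mean_form k n c" "\<forall>n>0. G n = mean_form k n c'"
    by (auto simp: mean_representable_def)
  then have "\<forall>n>0. F n + G n = mean_form k n (\<lambda>l. c l + c' l)"
    by (simp add: mean_form_def const_poly_add distrib_right sum.distrib)
  then show ?thesis unfolding mean_representable_def by blast
qed

lemma mean_representable_scale:
  assumes "mean_representable k F"
  shows "mean_representable k (\<lambda>n. const_poly a * F n)"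
proof -
  from assms obtain c where "\<forall>n>0. F n = mean_form k n c"
    by (auto simp: mean_representable_def)
  then have "\<forall>n>0. const_poly a * F n = mean_form k n (\<lambda>l. a * c l)"
    by (simp add: mean_form_def const_poly_mult sum_distrib_left mult.assoc)
  then show ?thesis unfolding mean_representable_def by blast
qed

lemma mean_representable_diff:
  assumes "mean_representable k F" "mean_representable k G"
  shows "mean_representable k (\<lambda>n. F n - G n)"
  using mean_representable_add[OF assms(1) mean_representable_scale[OF assms(2), of "-1"]]
  by (simp add: const_poly_uminus)

lemma mean_representable_sum:
  assumes "\<And>i. i \<in> A \<Longrightarrow> mean_representable k (F i)"
  shows "mean_representable k (\<lambda>n. \<Sum>i\<in>A. F i n)"
  using assms
proof (induction A rule: infinite_finite_induct)
  case (insert i A)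
  then show ?case by (auto intro: mean_representable_add)
qed (auto simp: mean_representable_def mean_form_def intro!: exI[of _ "\<lambda>_. 0"])

lemma mean_representable_part:
  assumes "l \<in> number_partitions k"
  shows "mean_representable k (\<lambda>n. power_mean_part n l)"
  unfolding mean_representable_def
proof (intro exI allI impI)
  fix n :: nat
  have "mean_form k n (\<lambda>l'. if l' = l then 1 else 0)
      = (\<Sum>l'\<in>number_partitions k. if l' = l then power_mean_part n l else 0)"
    unfolding mean_form_def by (intro sum.cong) auto
  also have "\<dots> = power_mean_part n l"
    using assms by (simp add: finite_number_partitions)
  finally show "power_mean_part n l = mean_form k n (\<lambda>l'. if l' = l then 1 else 0)" ..
qed

text \<open>A partition of \<open>j\<close> plus one of \<open>k\<close>, as multisets, is a
  partition of j + k. Several pairs may give the same one; closure under sums collects the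
  terms.\<close>

lemma mean_representable_mult:
  assumes "mean_representable j F" "mean_representable k G"
  shows "mean_representable (j + k) (\<lambda>n. F n * G n)"
proof -
  from assms obtain c c' where c: "\<forall>n>0. F n = mean_form j n c" "\<forall>n>0. G n = mean_form k n c'"
    by (auto simp: mean_representable_def)
  have "mean_representable (j + k) (\<lambda>n. \<Sum>l\<in>number_partitions j. \<Sum>l'\<in>number_partitions k.
      const_poly (c l * c' l') * power_mean_part n (l + l'))"
    by (intro mean_representable_sum mean_representable_scale mean_representable_part)
      (auto simp: number_partitions_def)
  then show ?thesis
  proof (rule mean_representable_cong)
    fix n :: nat
    assume "n > 0"
    then have "F n * G n = (\<Sum>l\<in>number_partitions j. \<Sum>l'\<in>number_partitions k.
        (const_poly (c l) * power_mean_part n l) * (const_poly (c' l') * power_mean_part n l'))"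
      using c by (simp add: mean_form_def sum_product)
    also have "\<dots> = (\<Sum>l\<in>number_partitions j. \<Sum>l'\<in>number_partitions k.
        const_poly (c l * c' l') * power_mean_part n (l + l'))"
      by (simp add: const_poly_mult power_mean_part_def ac_simps)
    finally show "(\<Sum>l\<in>number_partitions j. \<Sum>l'\<in>number_partitions k.
        const_poly (c l * c' l') * power_mean_part n (l + l')) = F n * G n" ..
  qed
qed

lemma mean_representable_one: "mean_representable 0 (\<lambda>n. 1)"
  using mean_representable_part[of "{#}" 0] by (simp add: power_mean_part_def number_partitions_0)

lemma mean_representable_power:
  "mean_representable k F \<Longrightarrow> mean_representable (e * k) (\<lambda>n. F n ^ e)"
  by (induction e) (auto intro: mean_representable_mult mean_representable_one)

lemma mean_representable_power_mean: "mean_representable r (\<lambda>n. power_mean n r)"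
proof (cases "r = 0")
  \<comment> \<open>0 is not a part of a partition, so the zeroth mean is represented as the
    constant 1.\<close>
  case True
  then show ?thesis
    by (auto intro!: mean_representable_cong[OF mean_representable_one]
        simp: power_mean_def mean_const_poly)
next
  case False
  then show ?thesis
    using mean_representable_part[of "{#r#}" r]
    by (simp add: power_mean_part_def number_partitions_def)
qed

section \<open>Central moments as forms in the power means\<close>

definition central_moment :: "nat \<Rightarrow> nat \<Rightarrow> rpoly" where
  "central_moment r n = const_poly (1 / real n) * (\<Sum>i=1..n. (var_poly i - power_mean n 1) ^ r)"

lemma mean_representable_central_moment: "mean_representable r (central_moment r)"
proof -
  have "mean_representable r (\<lambda>n. \<Sum>j\<le>r. const_poly (of_nat (r choose j) * (-1) ^ (r - j)) *
      (power_mean n j * power_mean n 1 ^ (r - j)))"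
  proof (intro mean_representable_sum mean_representable_scale)
    fix j assume "j \<in> {..r}"
    then show "mean_representable r (\<lambda>n. power_mean n j * power_mean n 1 ^ (r - j))"
      using mean_representable_mult[OF mean_representable_power_mean[of j]
          mean_representable_power[OF mean_representable_power_mean[of 1], of "r - j"]]
      by simp
  qed
  then show ?thesis
  proof (rule mean_representable_cong)
    fix n :: nat
    have m1: "const_poly ((-1) ^ e) = (-1) ^ e" for e
      by (induction e) (simp_all add: const_poly_uminus)
    have "central_moment r n = const_poly (1 / real n) * (\<Sum>i=1..n. \<Sum>j\<le>r.
        of_nat (r choose j) * var_poly i ^ j * (- power_mean n 1) ^ (r - j))"
      unfolding central_moment_def by (simp flip: binomial_ring)
    also have "\<dots> = const_poly (1 / real n) * (\<Sum>j\<le>r.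
        of_nat (r choose j) * (\<Sum>i=1..n. var_poly i ^ j) * (- power_mean n 1) ^ (r - j))"
      by (subst sum.swap) (simp add: sum_distrib_left sum_distrib_right)
    also have "\<dots> = (\<Sum>j\<le>r. const_poly (of_nat (r choose j) * (-1) ^ (r - j)) *
      (power_mean n j * power_mean n 1 ^ (r - j)))"
      unfolding sum_distrib_left[of "const_poly (1 / real n)"]
    proof (rule sum.cong)
      fix j
      show "const_poly (1 / real n) *
          (of_nat (r choose j) * (\<Sum>i=1..n. var_poly i ^ j) * (- power_mean n 1) ^ (r - j)) =
        const_poly (of_nat (r choose j) * (-1) ^ (r - j)) *
          (power_mean n j * power_mean n 1 ^ (r - j))"
        unfolding power_minus[of "power_mean n 1"] const_poly_mult const_poly_of_nat m1
          power_mean_def[of n j]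
        by (simp only: ac_simps)
    qed simp
    finally show "(\<Sum>j\<le>r. const_poly (of_nat (r choose j) * (-1) ^ (r - j)) *
      (power_mean n j * power_mean n 1 ^ (r - j))) = central_moment r n" ..
  qed
qed

lemma poly_eval_central_moment:
  "poly_eval (central_moment r n) x = (\<Sum>i=1..n. (x i - (\<Sum>i=1..n. x i) / real n) ^ r) / real n"
  by (simp add: central_moment_def)

text \<open>
  At the points of \<open>n = 4 m\<close> coordinates \<open>s + P + Q\<close>, \<open>s + P - Q\<close>, \<open>s - P - Q\<close>, \<open>s - P + Q\<close>,
  each repeated \<open>m\<close> times, this takes the value
  \<open>s\<^sup>e (s\<^sup>6 - 12 s\<^sup>2 P\<^sup>2 Q\<^sup>2 + 8 P\<^sup>4 Q\<^sup>2 + 8 P\<^sup>2 Q\<^sup>4)\<close>, a rescaled Motzkin form.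
\<close>
definition motzkin_mean :: "nat \<Rightarrow> nat \<Rightarrow> rpoly" where
  "motzkin_mean e n = power_mean n 1 ^ e *
    (central_moment 6 n - central_moment 2 n * central_moment 4 n
      - 3 * (power_mean n 1 ^ 2 * (central_moment 4 n - central_moment 2 n ^ 2))
      + power_mean n 1 ^ 6)"

lemma mean_representable_motzkin_mean: "mean_representable (e + 6) (motzkin_mean e)"
proof -
  note cm = mean_representable_central_moment
  have p: "mean_representable k (\<lambda>n. power_mean n 1 ^ k)" for k
    using mean_representable_power[OF mean_representable_power_mean[of 1], of k] by simp
  have a: "mean_representable 6 (\<lambda>n. central_moment 2 n * central_moment 4 n)"
    using mean_representable_mult[OF cm[of 2] cm[of 4]] by simp
  have "mean_representable 4 (\<lambda>n. central_moment 2 n ^ 2)"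
    using mean_representable_power[OF cm[of 2], of 2] by simp
  from mean_representable_mult[OF p[of 2] mean_representable_diff[OF cm[of 4] this]]
  have "mean_representable 6
      (\<lambda>n. const_poly 3 * (power_mean n 1 ^ 2 * (central_moment 4 n - central_moment 2 n ^ 2)))"
    by (intro mean_representable_scale) simp
  note mean_representable_mult[OF p[of e] mean_representable_add[OF mean_representable_diff[OF
        mean_representable_diff[OF cm[of 6] a] this] p[of 6]]]
  then show ?thesis by (simp add: motzkin_mean_def[abs_def])
qed

section \<open>Nonnegativity of the Motzkin form\<close>

lemma sum_Cauchy_Schwarz_even_powers:
  fixes y :: "'a \<Rightarrow> real"
  shows "(\<Sum>i\<in>A. y i ^ 4) ^ 2 \<le> (\<Sum>i\<in>A. y i ^ 2) * (\<Sum>i\<in>A. y i ^ 6)"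
proof -
  have "(\<Sum>i\<in>A. y i * y i ^ 3) ^ 2 \<le> (\<Sum>i\<in>A. y i ^ 2) * (\<Sum>i\<in>A. (y i ^ 3) ^ 2)"
    by (rule Cauchy_Schwarz_ineq_sum)
  then show ?thesis by (simp flip: power_Suc power_mult)
qed

text \<open>Put w^2 = m4 - v^2. For v > 0, m6 - v m4 \<ge> m4^2 / v - v m4 = w^4 / v + w^2 v \<ge> 2
  w^3, and s^6 + 2 w^3 \<ge> 3 s^2 w^2 is the inequality of the means for s^6, w^3, w^3.\<close>

lemma motzkin_moment_inequality:
  fixes v m4 m6 s :: real
  assumes v: "v \<ge> 0" and m4: "m4 \<ge> v ^ 2" and m6: "m6 \<ge> 0" "m4 ^ 2 \<le> v * m6"
  shows "m6 - v * m4 - 3 * (s ^ 2 * (m4 - v ^ 2)) + s ^ 6 \<ge> 0"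
proof (cases "v = 0")
  case True
  \<comment> \<open>Here m4^2 \<le> 0, so m4 = 0 and only m6 + s^6 is left.\<close>
  then show ?thesis using m6 by simp
next
  case False
  then have v: "v > 0" using v by simp
  define w where "w = sqrt (m4 - v ^ 2)"
  have w: "w \<ge> 0" "m4 = w ^ 2 + v ^ 2" using m4 by (simp_all add: w_def)
  have "2 * w ^ 3 \<le> w ^ 4 / v + w ^ 2 * v"
  proof -
    have "0 \<le> w ^ 2 * (w - v) ^ 2 / v" using v by simp
    also have "\<dots> = w ^ 4 / v + w ^ 2 * v - 2 * w ^ 3"
      using v by (simp add: field_simps power2_eq_square power3_eq_cube power4_eq_xxxx)
    finally show ?thesis by simp
  qed
  also have "\<dots> = m4 ^ 2 / v - v * m4"
    using v unfolding w(2) by (simp add: field_simps power2_eq_square power4_eq_xxxx)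
  also have "m4 ^ 2 / v \<le> m6" using m6 v by (simp add: divide_le_eq mult.commute)
  finally have 1: "2 * w ^ 3 \<le> m6 - v * m4" by simp
  have "0 \<le> (s ^ 2 - w) ^ 2 * (s ^ 2 + 2 * w)" using w by simp
  also have "\<dots> = s ^ 6 + 2 * w ^ 3 - 3 * (s ^ 2 * w ^ 2)"
    by (simp add: power2_eq_square power3_eq_cube eval_nat_numeral algebra_simps)
  finally show ?thesis using 1 w by simp
qed

lemma poly_eval_motzkin_mean_nonneg:
  assumes "even e" and n: "n > 0"
  shows "poly_eval (motzkin_mean e n) x \<ge> 0"
proof -
  define y where "y i = x i - (\<Sum>i=1..n. x i) / real n" for i
  define m where "m r = (\<Sum>i=1..n. y i ^ r) / real n" for r
  define s where "s = (\<Sum>i=1..n. x i) / real n"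
  have m: "poly_eval (central_moment r n) x = m r" for r
    by (simp add: poly_eval_central_moment m_def y_def)
  have "(\<Sum>i=1..n. y i ^ 2) ^ 2 \<le> (\<Sum>i=1..n. 1 ^ 2) * (\<Sum>i=1..n. (y i ^ 2) ^ 2)"
    using Cauchy_Schwarz_ineq_sum[of "\<lambda>_. 1" "\<lambda>i. y i ^ 2" "{1..n}"] by simp
  then have "(\<Sum>i=1..n. y i ^ 2) ^ 2 \<le> real n * (\<Sum>i=1..n. y i ^ 4)"
    by (simp flip: power_mult)
  then have m4: "m 4 \<ge> m 2 ^ 2"
    using n by (simp add: m_def field_simps power2_eq_square)
  have m6: "m 4 ^ 2 \<le> m 2 * m 6"
    using n sum_Cauchy_Schwarz_even_powers[of y "{1..n}"]
    by (simp add: m_def power2_eq_square divide_right_mono)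
  have "m 6 - m 2 * m 4 - 3 * (s ^ 2 * (m 4 - m 2 ^ 2)) + s ^ 6 \<ge> 0"
    using m4 m6 by (intro motzkin_moment_inequality) (simp_all add: m_def sum_nonneg)
  then show ?thesis
    using \<open>even e\<close> by (simp add: motzkin_mean_def m s_def zero_le_even_power)
qed

subsection \<open>Restriction to lines\<close>

definition line_poly :: "(nat \<Rightarrow> real) \<Rightarrow> (nat \<Rightarrow> real) \<Rightarrow> rpoly \<Rightarrow> real poly" where
  "line_poly x u g = (\<Sum>m\<in>Poly_Mapping.keys g. smult (Poly_Mapping.lookup g m)
    (\<Prod>i\<in>Poly_Mapping.keys m. [:x i, u i:] ^ Poly_Mapping.lookup m i))"

lemma poly_line_poly: "poly (line_poly x u g) t = poly_eval g (\<lambda>i. x i + t * u i)"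
  by (simp add: line_poly_def poly_eval_def poly_sum poly_prod poly_power)

text \<open>Linearity of the differential in terms of Taylor coefficients, for restrictions to lines
  through one point in directions u, v and u + v. As a relation of three polynomials it passes to
  products by the Leibniz rule.\<close>

definition first_order_additive :: "real poly \<Rightarrow> real poly \<Rightarrow> real poly \<Rightarrow> bool" where
  "first_order_additive p q r \<longleftrightarrow> coeff p 0 = coeff r 0 \<and> coeff q 0 = coeff r 0 \<and>
    coeff r 1 = coeff p 1 + coeff q 1"

lemma first_order_additive_one: "first_order_additive 1 1 1"
  by (simp add: first_order_additive_def)

lemma first_order_additive_mult:
  assumes "first_order_additive p q r" "first_order_additive p' q' r'"
  shows "first_order_additive (p * p') (q * q') (r * r')"
  using assms by (simp add: first_order_additive_def coeff_mult algebra_simps)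

lemma first_order_additive_power:
  "first_order_additive p q r \<Longrightarrow> first_order_additive (p ^ k) (q ^ k) (r ^ k)"
  by (induction k) (simp_all add: first_order_additive_one first_order_additive_mult)

lemma first_order_additive_prod:
  "(\<And>i. i \<in> A \<Longrightarrow> first_order_additive (p i) (q i) (r i)) \<Longrightarrow>
    first_order_additive (prod p A) (prod q A) (prod r A)"
  by (induction A rule: infinite_finite_induct)
    (simp_all add: first_order_additive_one first_order_additive_mult)

lemma first_order_additive_line_poly:
  "first_order_additive (line_poly x u g) (line_poly x v g) (line_poly x (\<lambda>i. u i + v i) g)"
proof -
  have *: "first_order_additive
      (\<Prod>i\<in>Poly_Mapping.keys m. [:x i, u i:] ^ Poly_Mapping.lookup m i)
      (\<Prod>i\<in>Poly_Mapping.keys m. [:x i, v i:] ^ Poly_Mapping.lookup m i)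
      (\<Prod>i\<in>Poly_Mapping.keys m. [:x i, u i + v i:] ^ Poly_Mapping.lookup m i)" for m
    by (intro first_order_additive_prod first_order_additive_power)
      (simp add: first_order_additive_def)
  show ?thesis
    using * unfolding first_order_additive_def line_poly_def
    by (simp add: coeff_sum distrib_left sum.distrib)
qed

section \<open>Degrees in sums of squares in one variable\<close>

lemma coeff_sum_list: "coeff (sum_list ps) k = (\<Sum>p\<leftarrow>ps. coeff p k)"
  by (induction ps) simp_all

text \<open>\<open>N\<close> only bounds the degree: if the degree is smaller, both sides are
  0.\<close>

lemma coeff_square_double:
  fixes p :: "'a :: comm_semiring_1 poly"
  assumes "degree p \<le> N"
  shows "coeff (p ^ 2) (2 * N) = coeff p N ^ 2"
proof (cases "degree p = N")
  case True
  then show ?thesis using coeff_mult_degree_sum[of p p] by (simp add: power2_eq_square mult_2)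
next
  case False
  then have "degree p < N" using assms by simp
  moreover have "degree (p ^ 2) \<le> 2 * degree p" using degree_power_le[of p 2] by (simp add: mult.commute)
  ultimately show ?thesis by (simp add: coeff_eq_0)
qed

text \<open>Leading terms cannot cancel: if the largest degree N exceeded k, the coefficient of
  order 2 N in the sum would be a sum of real squares, not all zero.\<close>

lemma degree_le_of_sum_of_squares:
  fixes ps :: "real poly list"
  assumes deg: "degree (\<Sum>p\<leftarrow>ps. p ^ 2) \<le> 2 * k" and p: "p \<in> set ps"
  shows "degree p \<le> k"
proof -
  define N where "N = Max (degree ` set ps)"
  have le: "degree q \<le> N" if "q \<in> set ps" for q
    using that by (simp add: N_def)
  have "N \<in> degree ` set ps" unfolding N_def using p by (intro Max_in) auto
  then obtain q where q: "q \<in> set ps" "degree q = N" by auto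
  have "N \<le> k"
  proof (rule ccontr)
    assume N: "\<not> N \<le> k"
    then have "0 = coeff (\<Sum>p\<leftarrow>ps. p ^ 2) (2 * N)" using deg by (simp add: coeff_eq_0)
    also have "\<dots> = (\<Sum>p\<leftarrow>ps. coeff (p ^ 2) (2 * N))"
      by (simp add: coeff_sum_list o_def)
    also have "\<dots> = (\<Sum>p\<leftarrow>ps. coeff p N ^ 2)"
      using le by (intro arg_cong[of _ _ sum_list] map_cong) (auto simp: coeff_square_double)
    finally have "(\<Sum>p\<leftarrow>ps. coeff p N ^ 2) = 0" ..
    then have "coeff q N ^ 2 = 0"
      using q by (subst (asm) sum_list_nonneg_eq_0_iff) auto
    then have "q = 0" using q by auto
    then show False using q N by simp
  qed
  then show ?thesis using le[OF p] by simp
qed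

section \<open>Points made of four equal blocks of coordinates\<close>

lemma sum_blocks_mod_4:
  "(\<Sum>i=1..4*k. h (i mod 4)) = of_nat k * (h 0 + h 1 + h 2 + h 3 :: 'a :: comm_ring_1)"
proof (induction k)
  case (Suc k)
  have "4 * Suc k = Suc (Suc (Suc (Suc (4 * k))))" by simp
  moreover have "Suc (4 * k) mod 4 = 1" "Suc (Suc (4 * k)) mod 4 = 2"
    "Suc (Suc (Suc (4 * k))) mod 4 = 3" "Suc (Suc (Suc (Suc (4 * k)))) mod 4 = 0"
    by presburger+
  ultimately have "(\<Sum>i=1..4 * Suc k. h (i mod 4)) =
      (\<Sum>i=1..4*k. h (i mod 4)) + h 1 + h 2 + h 3 + h 0"
    by (simp only: sum.cl_ivl_Suc) simp
  then show ?case using Suc by (simp add: algebra_simps)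
qed simp

text \<open>As the values of \<open>a\<close> sum to 0, the point has mean 1 and deviations t a.
  Hence the factor with exponent \<open>e\<close> is 1, and m r is the central moment of order
  r.\<close>

lemma poly_eval_motzkin_mean_blocks:
  fixes a :: "nat \<Rightarrow> real" and t :: real
  assumes k: "k > 0" and a: "a 0 + a 1 + a 2 + a 3 = 0"
  defines "m \<equiv> \<lambda>r. t ^ r * ((a 0 ^ r + a 1 ^ r + a 2 ^ r + a 3 ^ r) / 4)"
  shows "poly_eval (motzkin_mean e (4 * k)) (\<lambda>i. 1 + t * a (i mod 4)) =
    m 6 - m 2 * m 4 - 3 * (m 4 - m 2 ^ 2) + 1"
proof -
  have "(\<Sum>i=1..4*k. 1 + t * a (i mod 4)) = 4 * k + t * (k * (a 0 + a 1 + a 2 + a 3))"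
    using sum_blocks_mod_4[of "\<lambda>j. 1 + t * a j" k] by (simp add: algebra_simps)
  then have p1: "(\<Sum>i=1..4*k. 1 + t * a (i mod 4)) / real (4 * k) = 1"
    using k a by simp
  have cm: "poly_eval (central_moment r (4 * k)) (\<lambda>i. 1 + t * a (i mod 4)) = m r" for r
    unfolding poly_eval_central_moment p1
    using sum_blocks_mod_4[of "\<lambda>j. (t * a j) ^ r" k] k
    by (simp add: m_def power_mult_distrib field_simps)
  show ?thesis
    using p1 by (simp add: motzkin_mean_def cm)
qed

lemma motzkin_mean_not_sos:
  assumes k: "k > 0"
  shows "\<not> sum_of_squares (4 * k) (motzkin_mean e (4 * k))"
proof
  assume "sum_of_squares (4 * k) (motzkin_mean e (4 * k))"
  then obtain gs where gs: "motzkin_mean e (4 * k) = (\<Sum>g\<leftarrow>gs. g ^ 2)"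
    unfolding sum_of_squares_def by blast
  define L where "L a = line_poly (\<lambda>_. 1) (\<lambda>i. a (i mod 4))" for a :: "nat \<Rightarrow> real"
  have L: "poly (\<Sum>p\<leftarrow>map (L a) gs. p ^ 2) t =
      poly_eval (motzkin_mean e (4 * k)) (\<lambda>i. 1 + t * a (i mod 4))" for a t
    unfolding gs poly_eval_sum_list
    by (induction gs) (simp_all add: L_def poly_line_poly poly_power)
  \<comment> \<open>The pairs (a j, b j) run through all four sign patterns: \<open>a\<close> and
    \<open>b\<close> are the directions of P and Q, and \<open>c\<close> is the diagonal P = Q =
    t.\<close>
  define a b c :: "nat \<Rightarrow> real" where "a j = (if j = 0 \<or> j = 2 then 1 else - 1)"
    and "b j = (if j = 0 \<or> j = 3 then 1 else - 1)" and "c j = a j + b j" for j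
  \<comment> \<open>All deviations have absolute value |t|, so m2 = t^2, m4 = t^4, m6 = t^6 and
    everything but the constant cancels.\<close>
  have "poly (\<Sum>p\<leftarrow>map (L a) gs. p ^ 2) t = poly 1 t" for t
    unfolding L by (subst poly_eval_motzkin_mean_blocks[OF k]) (simp_all add: a_def flip: power_mult power_add)
  then have La: "(\<Sum>p\<leftarrow>map (L a) gs. p ^ 2) = 1"
    using poly_eq_poly_eq_iff by blast
  have "poly (\<Sum>p\<leftarrow>map (L b) gs. p ^ 2) t = poly 1 t" for t
    unfolding L by (subst poly_eval_motzkin_mean_blocks[OF k]) (simp_all add: b_def flip: power_mult power_add)
  then have Lb: "(\<Sum>p\<leftarrow>map (L b) gs. p ^ 2) = 1"
    using poly_eq_poly_eq_iff by blast
  \<comment> \<open>The deviations are 2 t, -2 t, 0, 0, so m2 = 2 t^2, m4 = 8 t^4, m6 = 32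
    t^6.\<close>
  have "poly (\<Sum>p\<leftarrow>map (L c) gs. p ^ 2) t = poly [:1, 0, 0, 0, - 12, 0, 16:] t" for t
    unfolding L
    by (subst poly_eval_motzkin_mean_blocks[OF k])
      (simp_all add: a_def b_def c_def eval_nat_numeral algebra_simps)
  then have Lc: "(\<Sum>p\<leftarrow>map (L c) gs. p ^ 2) = [:1, 0, 0, 0, - 12, 0, 16:]"
    using poly_eq_poly_eq_iff by blast
  have "coeff (L c g ^ 2) 4 \<ge> 0" if g: "g \<in> set gs" for g
  proof -
    have "degree (L a g) \<le> 0"
      by (rule degree_le_of_sum_of_squares[of "map (L a) gs"], unfold La) (use g in auto)
    moreover have "degree (L b g) \<le> 0"
      by (rule degree_le_of_sum_of_squares[of "map (L b) gs"], unfold Lb) (use g in auto)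
    ultimately have "coeff (L a g) 1 = 0" "coeff (L b g) 1 = 0" by (simp_all add: coeff_eq_0)
    moreover have "first_order_additive (L a g) (L b g) (L c g)"
      unfolding L_def c_def by (rule first_order_additive_line_poly)
    ultimately have 1: "coeff (L c g) 1 = 0" by (simp add: first_order_additive_def)
    \<comment> \<open>The coefficient of t^4 in the square is c2^2 + 2 c1 c3 + 2 c0 c4, where c1 = 0
      has just been shown and c4 = 0 follows from the degree.\<close>
    have "degree (L c g) \<le> 3"
      by (rule degree_le_of_sum_of_squares[of "map (L c) gs"], unfold Lc) (use g in auto)
    then have 4: "coeff (L c g) 4 = 0" by (simp add: coeff_eq_0)
    have "{..4::nat} = {0, 1, 2, 3, 4}" by auto
    then have "coeff (L c g ^ 2) 4 = coeff (L c g) 2 ^ 2"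
      using 1 4 by (simp add: power2_eq_square coeff_mult)
    then show ?thesis by simp
  qed
  then have "(\<Sum>g\<leftarrow>gs. coeff (L c g ^ 2) 4) \<ge> 0" by (intro sum_list_nonneg) auto
  also have "(\<Sum>g\<leftarrow>gs. coeff (L c g ^ 2) 4) = coeff (\<Sum>p\<leftarrow>map (L c) gs. p ^ 2) 4"
    by (simp add: coeff_sum_list o_def)
  also have "\<dots> = - 12" unfolding Lc by (simp add: coeff_pCons eval_nat_numeral)
  finally show False by simp
qed

text \<open>A single n refutes membership in \<open>sos_cone\<close>: n = 4 d is at least 2 d and
  divisible by 4. The exponent 2 d - 6 is even and, as d \<ge> 3, not truncated.\<close>

lemma sos_cone_psubset_nonneg_cone:
  assumes d: "d \<ge> 3"
  shows "sos_cone (2 * d) \<subset> nonneg_cone (2 * d)"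
proof -
  obtain c' where c': "motzkin_mean (2 * d - 6) n = mean_form (2 * d) n c'" if "n > 0" for n
    using mean_representable_motzkin_mean[of "2 * d - 6"] d by (auto simp: mean_representable_def)
  define c where "c = restrict c' (number_partitions (2 * d))"
  have c: "mean_form (2 * d) n c = motzkin_mean (2 * d - 6) n" if "n > 0" for n
    using c'[OF that] by (simp add: c_def mean_form_restrict)
  have "c \<in> nonneg_cone (2 * d)"
    using d by (auto simp: nonneg_cone_def nonneg_poly_def c poly_eval_motzkin_mean_nonneg)
      (auto simp: c_def)
  moreover have "c \<notin> sos_cone (2 * d)"
    using motzkin_mean_not_sos[of d "2 * d - 6"] d
    by (auto simp: sos_cone_def c intro!: exI[of _ "4 * d"])
  ultimately show ?thesis using sos_cone_subset_nonneg_cone by blast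
qed

theorem theorem1p5:
  fixes d :: nat
  assumes "d \<ge> 1"
  shows "sos_cone (2 * d) \<subset> nonneg_cone (2 * d) \<longleftrightarrow> 2 * d \<ge> 6"
proof
  assume strict: "sos_cone (2 * d) \<subset> nonneg_cone (2 * d)"
  have "d \<noteq> 1" "d \<noteq> 2"
    using strict nonneg_cone_2_subset_sos_cone nonneg_cone_4_subset_sos_cone by auto
  then show "2 * d \<ge> 6" using assms by simp
next
  assume "2 * d \<ge> 6"
  then show "sos_cone (2 * d) \<subset> nonneg_cone (2 * d)"
    by (intro sos_cone_psubset_nonneg_cone) simp
qed

end
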